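(* Let $d\ge 1$, $\beta>0$, and let $\phi$ be a stable, tempered and lower-regular pair potential on $\mathbb{R}^d$. Let $\mathcal{B}$ be an admissible collection of boundary conditions such that, for every $x>0$ and every $b\in\mathcal{B}$, the limit $$p(x)=\lim_{L\to\infty}p(x;\Lambda_L,b)$$ exists and is independent of $b\in\mathcal{B}$. Fix $z_0>0$ and $b\in\mathcal{B}$. Suppose that for some $\delta>0$ the function $\Xi(\,\cdot\,;\Lambda_L,b)$ has no zeros in the open disc $B_\delta(z_0)=\{z\in\mathbb{C}:|z-z_0|<\delta\}$ for all sufficiently large $L$. Then $p$ has a holomorphic extension to a neighborhood of $z_0$ in $\mathbb{C}$ (i.e. there are an open set $U\ni z_0$ in $\mathbb{C}$ and a holomorphic function on $U$ that coincides with $p$ on $U\cap(0,\infty)$), and for every $n\ge 1$, $$\lim_{L\to\infty}\partial_z^n\,p(z_0;\Lambda_L,b)=\partial_z^n\,p(z_0).$$ The value on the right is independent of $b$ among boundary conditions $b\in\mathcal{B}$ satisfying the zero-free hypothesis at $z_0$.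
   Context: Pair potential: $\phi$ is a measurable radial function on $\mathbb{R}^d$ with values in $\mathbb{R}\cup\{+\infty\}$, written $\phi(x)=\phi(|x|)$, and $\phi(x_1,\dots,x_N)=\sum_{i<j}\phi(|x_i-x_j|)$. It is: stable if there is $B\ge 0$ with $\phi(x_1,\dots,x_N)\ge -BN$ for every finite configuration; tempered if there are $R_0\ge 0$, $\varepsilon>0$ with $\phi(x)\le |x|^{-(d+\varepsilon)}$ for all $|x|\ge R_0$; lower-regular if there are $R_1\ge 0$ and a decreasing (non-increasing) $\psi:[R_1,\infty)\to[0,\infty)$ with $\phi(x)\ge-\psi(|x|)$ for all $|x|\ge R_1$ and $\int_{R_1}^\infty\psi(r)r^{d-1}\,dr<\infty$. Cubes: $\Lambda_L=[-L,L]^d$, $L\ge1$; $|\Lambda|$ is the volume. Boundary conditions: a boundary condition $b$ is either a configuration of particles (a locally finite set of points of $\mathbb{R}^d$), of which the points in $\Lambda^c$ act on the particles in $\Lambda$, or the periodic boundary condition. For a configuration, $\phi_b(x)=\sum_{y\in b\cap\Lambda^c}\phi(x-y)$ is the energy of a particle at $x\in\Lambda$ due to $b$; if the sum of the positive parts $\phi^+=\max(\phi,0)$ diverges, $\phi_b(x):=+\infty$ and $e^{-\beta\phi_b(x)}:=0$; the convention $0\cdot\infty=0$ is used. For the periodic boundary condition in $\Lambda_L$, $\phi_b=0$ and $\phi(|x_i-x_j|)$ is replaced by $\sum_{k\in(2L\mathbb{Z})^d}\phi(|x_i-x_j+k|)$ (with value $+\infty$ if the positive parts diverge). Grand canonical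 partition function, with fugacity $z=e^{\beta\mu}$: $$\Xi(z;\Lambda,b)=\sum_{N=0}^\infty\frac{z^N}{N!}\int_{\Lambda^N}e^{-\beta\phi(x_1,\dots,x_N)}\prod_{i=1}^N e^{-\beta\phi_b(x_i)}\,dx_1\cdots dx_N,$$ with $N=0$ term equal to $1$. For real $x>0$ the finite-volume pressure is $p(x;\Lambda,b)=|\Lambda|^{-1}\log\Xi(x;\Lambda,b)$. $\partial_z^n p(z_0;\Lambda_L,b)$ and $\partial_z^n p(z_0)$ denote $n$-th derivatives with respect to fugacity at the point $z_0$. Admissibility: a collection $\mathcal{B}$ of boundary conditions is admissible if there are constants $c_1,c_2<\infty$ and $L_1<\infty$ such that $$|\Lambda_L|^{-1}\log\Xi(|z|;\Lambda_L,b)\le c_1|z|+c_2\quad\text{for all }z\in\mathbb{C},\ b\in\mathcal{B},\ L\ge L_1.$$ *)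

theory Defs
  imports "HOL-Analysis.Analysis"
begin

text \<open>The dimension of space is \<open>CARD('d)\<close>; Euclidean space is \<^typ>\<open>real^'d\<close>.
  Values \<open>+\<infinity>\<close> (hard cores) are allowed for the potential, \<open>-\<infinity>\<close> is not.\<close>

definition pair_potential :: "(real^'d \<Rightarrow> ereal) \<Rightarrow> bool" where
  "pair_potential \<phi> \<longleftrightarrow>
     \<phi> \<in> borel_measurable lebesgue \<and>
     (\<forall>x y. norm x = norm y \<longrightarrow> \<phi> x = \<phi> y) \<and>
     (\<forall>x. \<phi> x \<noteq> -\<infinity>)"

text \<open>A finite configuration is a finite set of points, enumerated as \<open>x 0, \<dots>, x (N - 1)\<close>
  without repetition. So stability says nothing about \<open>\<phi> 0\<close>; it is implied by the variant in
  which points may coincide.\<close>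

definition stable_potential :: "(real^'d \<Rightarrow> ereal) \<Rightarrow> bool" where
  "stable_potential \<phi> \<longleftrightarrow>
     (\<exists>B\<ge>0. \<forall>N. \<forall>x :: nat \<Rightarrow> real^'d. inj_on x {..<N} \<longrightarrow>
        ereal (- B * real N) \<le> (\<Sum>j<N. \<Sum>i<j. \<phi> (x i - x j)))"

text \<open>\<open>R\<^sub>0\<close> may be enlarged, so the value of \<open>powr\<close> at \<open>0\<close> is irrelevant.\<close>

definition tempered :: "(real^'d \<Rightarrow> ereal) \<Rightarrow> bool" where
  "tempered \<phi> \<longleftrightarrow>
     (\<exists>R\<^sub>0\<ge>0. \<exists>\<epsilon>>0. \<forall>x. norm x \<ge> R\<^sub>0 \<longrightarrow>
        \<phi> x \<le> ereal (norm x powr (- (real CARD('d) + \<epsilon>))))"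

definition lower_regular :: "(real^'d \<Rightarrow> ereal) \<Rightarrow> bool" where
  "lower_regular \<phi> \<longleftrightarrow>
     (\<exists>R\<^sub>1\<ge>0. \<exists>\<psi> :: real \<Rightarrow> real.
        (\<forall>r\<ge>R\<^sub>1. 0 \<le> \<psi> r) \<and>
        antimono_on {R\<^sub>1..} \<psi> \<and>
        (\<forall>x. norm x \<ge> R\<^sub>1 \<longrightarrow> - ereal (\<psi> (norm x)) \<le> \<phi> x) \<and>
        set_integrable lborel {R\<^sub>1..} (\<lambda>r. \<psi> r * r ^ (CARD('d) - 1)))"

definition cube :: "real \<Rightarrow> (real^'d) set" where
  "cube L = {x. \<forall>i. \<bar>x $ i\<bar> \<le> L}"

datatype 'a boundary_condition = Config "'a set" | Periodic

definition locally_finite :: "(real^'d) set \<Rightarrow> bool" where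
  "locally_finite X \<longleftrightarrow> (\<forall>K. bounded K \<longrightarrow> finite (X \<inter> K))"

definition is_boundary_condition :: "(real^'d) boundary_condition \<Rightarrow> bool" where
  "is_boundary_condition b \<longleftrightarrow>
     (case b of Config X \<Rightarrow> locally_finite X | Periodic \<Rightarrow> True)"

text \<open>Unordered sum of extended reals, with value \<open>+\<infinity>\<close> as soon as the positive parts diverge;
  \<^const>\<open>e2ennreal\<close> truncates negative values to \<open>0\<close>. If only the negative parts diverge, the
  value is \<open>-\<infinity>\<close>.\<close>

definition energy_sum :: "('a \<Rightarrow> ereal) \<Rightarrow> 'a set \<Rightarrow> ereal" where
  "energy_sum f A =
     (let P = (\<Sum>\<^sub>\<infinity>y\<in>A. e2ennreal (f y)); M = (\<Sum>\<^sub>\<infinity>y\<in>A. e2ennreal (- f y))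
      in if P = \<infinity> then \<infinity> else enn2ereal P - enn2ereal M)"

definition period_lattice :: "real \<Rightarrow> (real^'d) set" where
  "period_lattice L = {k. \<forall>i. \<exists>m::int. k $ i = 2 * L * of_int m}"

fun pair_energy ::
  "(real^'d \<Rightarrow> ereal) \<Rightarrow> real \<Rightarrow> (real^'d) boundary_condition \<Rightarrow> real^'d \<Rightarrow> real^'d \<Rightarrow> ereal" where
  "pair_energy \<phi> L (Config X) x y = \<phi> (x - y)"
| "pair_energy \<phi> L Periodic x y = energy_sum (\<lambda>k. \<phi> (x - y + k)) (period_lattice L)"

fun boundary_energy ::
  "(real^'d \<Rightarrow> ereal) \<Rightarrow> real \<Rightarrow> (real^'d) boundary_condition \<Rightarrow> real^'d \<Rightarrow> ereal" where
  "boundary_energy \<phi> L (Config X) x = energy_sum (\<lambda>y. \<phi> (x - y)) (X - cube L)"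
| "boundary_energy \<phi> L Periodic x = 0"

text \<open>\<open>exp (- \<beta> u)\<close> for an extended real energy \<open>u\<close> and \<open>\<beta> > 0\<close>. In \<^typ>\<open>ennreal\<close>,
  \<open>0 * \<infinity> = 0\<close>.\<close>

definition boltzmann :: "real \<Rightarrow> ereal \<Rightarrow> ennreal" where
  "boltzmann \<beta> u =
     (case u of ereal r \<Rightarrow> ennreal (exp (- \<beta> * r)) | PInfty \<Rightarrow> 0 | MInfty \<Rightarrow> \<infinity>)"

text \<open>The integral over \<open>\<Lambda>\<^sup>N\<close>, without the factor \<open>z\<^sup>N / N!\<close>. The completed product measure is
  Lebesgue measure on the \<open>N\<close>-fold power of \<^typ>\<open>real^'d\<close>.\<close>

definition config_integral ::
  "real \<Rightarrow> (real^'d \<Rightarrow> ereal) \<Rightarrow> real \<Rightarrow> (real^'d) boundary_condition \<Rightarrow> nat \<Rightarrow> ennreal" where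
  "config_integral \<beta> \<phi> L b N =
     (\<integral>\<^sup>+ x \<in> ({..<N} \<rightarrow>\<^sub>E cube L).
        boltzmann \<beta> (\<Sum>j<N. \<Sum>i<j. pair_energy \<phi> L b (x i) (x j)) *
        (\<Prod>i<N. boltzmann \<beta> (boundary_energy \<phi> L b (x i)))
      \<partial>completion (Pi\<^sub>M {..<N} (\<lambda>_. lborel)))"

lemma config_integral_0: "config_integral \<beta> \<phi> L b 0 = 1"
  by (simp add: config_integral_def nn_integral_completion PiM_empty boltzmann_def
      zero_ereal_def nn_integral_count_space_finite)

text \<open>The grand canonical partition function at real or complex fugacity \<open>z\<close>. It is meaningful
  only where all integrals are finite and the series converges; \<open>\<Xi>_nonneg\<close> is its
  \<open>[0,\<infinity>]\<close>-valued version for fugacity \<open>x \<ge> 0\<close>, which records whether this is the case.\<close>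

definition \<Xi> ::
  "real \<Rightarrow> (real^'d \<Rightarrow> ereal) \<Rightarrow> real \<Rightarrow> (real^'d) boundary_condition \<Rightarrow>
   'a::{real_normed_field,banach} \<Rightarrow> 'a" where
  "\<Xi> \<beta> \<phi> L b z = (\<Sum>N. z ^ N / fact N * of_real (enn2real (config_integral \<beta> \<phi> L b N)))"

definition \<Xi>_nonneg ::
  "real \<Rightarrow> (real^'d \<Rightarrow> ereal) \<Rightarrow> real \<Rightarrow> (real^'d) boundary_condition \<Rightarrow> real \<Rightarrow> ennreal" where
  "\<Xi>_nonneg \<beta> \<phi> L b x = (\<Sum>N. ennreal (x ^ N / fact N) * config_integral \<beta> \<phi> L b N)"

definition pressure ::
  "real \<Rightarrow> (real^'d \<Rightarrow> ereal) \<Rightarrow> real \<Rightarrow> (real^'d) boundary_condition \<Rightarrow> real \<Rightarrow> real" where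
  "pressure \<beta> \<phi> L b x = ln (\<Xi> \<beta> \<phi> L b x) / measure lborel (cube L :: (real^'d) set)"

text \<open>The bound on the logarithm includes finiteness of the partition function; this has to be
  said separately because \<^const>\<open>ln\<close> and \<open>\<Xi>\<close> are total functions.\<close>

definition admissible ::
  "real \<Rightarrow> (real^'d \<Rightarrow> ereal) \<Rightarrow> (real^'d) boundary_condition set \<Rightarrow> bool" where
  "admissible \<beta> \<phi> \<B> \<longleftrightarrow>
     (\<exists>c\<^sub>1 c\<^sub>2 L\<^sub>1. \<forall>z::complex. \<forall>b\<in>\<B>. \<forall>L. L \<ge> 1 \<and> L \<ge> L\<^sub>1 \<longrightarrow>
        \<Xi>_nonneg \<beta> \<phi> L b (norm z) < \<infinity> \<and>
        pressure \<beta> \<phi> L b (norm z) \<le> c\<^sub>1 * norm z + c\<^sub>2)"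

definition zero_free_near ::
  "real \<Rightarrow> (real^'d \<Rightarrow> ereal) \<Rightarrow> (real^'d) boundary_condition \<Rightarrow> real \<Rightarrow> bool" where
  "zero_free_near \<beta> \<phi> b z\<^sub>0 \<longleftrightarrow>
     (\<exists>\<delta>>0. \<forall>\<^sub>F L in at_top. \<forall>z\<in>ball (complex_of_real z\<^sub>0) \<delta>. \<Xi> \<beta> \<phi> L b z \<noteq> 0)"

end

(* On the disc where Xi(.; Lambda_L, b) has no zeros it has a holomorphic logarithm, and |Lambda_L|^{-1} times
   this logarithm has real part bounded above by admissibility and nonnegative at z_0 because Xi(x) >= 1
   for x >= 0. By Borel-Caratheodory its Taylor coefficients at z_0 are bounded by M / r^n uniformly in L.
   On the real axis only the real parts of the coefficients matter; these converge by induction on n,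
   because the n-th coefficient is, uniformly in L up to O(t), the quotient by t^n of the pressure at
   z_0 + t minus the lower-order terms. Dominated convergence makes the limits the Taylor coefficients
   of p, which replaces the Vitali-Porter theorem. *)
theory Submission
  imports Defs "HOL-Complex_Analysis.Complex_Analysis"
begin

section \<open>Bounds on Taylor coefficients from one-sided bounds on the real part\<close>

text \<open>Borel-Caratheodory at half the radius: Schwarz's lemma applies once the half plane
  containing the values of \<open>f - f z\<close> is mapped to the unit disc with 0 fixed. The
  general factor \<open>2 * \<rho> / (r - \<rho>)\<close> equals 2 at
  \<open>\<rho> = r / 2\<close>.\<close>

lemma Borel_Caratheodory_half:
  assumes hol: "f holomorphic_on ball z r" and "0 < r" "0 < K"
    and Re_less: "\<And>w. w \<in> ball z r \<Longrightarrow> Re (f w) < Re (f z) + K"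
    and w: "w \<in> cball z (r / 2)"
  shows "norm (f w - f z) \<le> 2 * K"
proof -
  define g where "g = (\<lambda>\<zeta>. f (z + of_real r * \<zeta>) - f z)"
  have in_ball: "z + of_real r * \<zeta> \<in> ball z r" if "norm \<zeta> < 1" for \<zeta>
    using that \<open>0 < r\<close> by (simp add: dist_norm norm_mult)
  have Re_g: "Re (g \<zeta>) < K" if "norm \<zeta> < 1" for \<zeta>
    using Re_less[OF in_ball[OF that]] by (simp add: g_def)
  have "(f \<circ> (\<lambda>\<zeta>. z + of_real r * \<zeta>)) holomorphic_on ball 0 1"
    by (rule holomorphic_on_compose_gen[OF _ hol])
       (use in_ball in \<open>auto intro!: holomorphic_intros\<close>)
  then have hol_g: "g holomorphic_on ball 0 1"
    unfolding g_def o_def by (intro holomorphic_intros)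
  \<comment> \<open>A Moebius map from the half plane \<open>Re w < K\<close> to the unit disc, for Schwarz's lemma.\<close>
  define h where "h = (\<lambda>\<zeta>. g \<zeta> / (2 * of_real K - g \<zeta>))"
  have nz: "2 * of_real K - g \<zeta> \<noteq> 0" if "norm \<zeta> < 1" for \<zeta>
  proof
    assume "2 * of_real K - g \<zeta> = 0"
    then have "Re (2 * of_real K - g \<zeta>) = 0" by simp
    with Re_g[OF that] \<open>0 < K\<close> show False by simp
  qed
  have less: "norm (g \<zeta>) < norm (2 * of_real K - g \<zeta>)" if "norm \<zeta> < 1" for \<zeta>
  proof -
    \<comment> \<open>The points 0 and \<open>2 * K\<close> are mirror images in the line
      \<open>Re w = K\<close>, so a value left of that line is closer to 0.\<close>
    have "0 < 4 * K * (K - Re (g \<zeta>))"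
      using Re_g[OF that] \<open>0 < K\<close> by simp
    also have "\<dots> = (norm (2 * of_real K - g \<zeta>))\<^sup>2 - (norm (g \<zeta>))\<^sup>2"
      unfolding cmod_power2 by (simp add: power2_eq_square algebra_simps)
    finally show ?thesis
      by (simp add: power2_less_imp_less)
  qed
  have "norm (h \<zeta>) \<le> norm \<zeta>" if "norm \<zeta> < 1" for \<zeta>
  proof (rule Schwarz_Lemma(1)[OF _ _ _ that])
    show "h holomorphic_on ball 0 1"
      unfolding h_def using nz by (intro holomorphic_intros hol_g) auto
    show "h 0 = 0" by (simp add: h_def g_def)
    show "norm (h \<xi>) < 1" if "norm \<xi> < 1" for \<xi>
      using less[OF that] nz[OF that] by (simp add: h_def norm_divide)
  qed
  then have le: "norm (g \<zeta>) \<le> norm \<zeta> * norm (2 * of_real K - g \<zeta>)" if "norm \<zeta> < 1" for \<zeta>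
    using that nz[OF that] by (simp add: h_def norm_divide divide_le_eq)
  define \<zeta> where "\<zeta> = (w - z) / of_real r"
  have norm_\<zeta>: "norm \<zeta> \<le> 1/2"
    using w \<open>0 < r\<close> by (simp add: \<zeta>_def norm_divide dist_norm norm_minus_commute divide_simps)
  have "norm (g \<zeta>) \<le> norm \<zeta> * norm (2 * of_real K - g \<zeta>)"
    using norm_\<zeta> by (intro le) simp
  \<comment> \<open>The unknown \<open>norm (g \<zeta>)\<close> now stands on both sides; the factor
    1/2 allows it to be absorbed.\<close>
  also have "\<dots> \<le> 1/2 * (2 * K + norm (g \<zeta>))"
    using norm_\<zeta> norm_triangle_ineq4[of "2 * of_real K" "g \<zeta>"] \<open>0 < K\<close>
    by (intro mult_mono) auto
  finally have "norm (g \<zeta>) \<le> 2 * K" by simp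
  moreover have "g \<zeta> = f w - f z"
    using \<open>0 < r\<close> by (simp add: g_def \<zeta>_def)
  ultimately show ?thesis by simp
qed

text \<open>Cauchy's inequality on the circle of radius \<open>r / 2\<close>, where the preceding
  estimate bounds \<open>norm (f w)\<close> by \<open>norm (f z) + 2 * K\<close>.\<close>

lemma Taylor_coeff_bound_Re_bound:
  assumes hol: "f holomorphic_on ball z r" and "0 < r" "0 < K"
    and Re_less: "\<And>w. w \<in> ball z r \<Longrightarrow> Re (f w) < Re (f z) + K"
  shows "norm ((deriv ^^ n) f z / fact n) \<le> (norm (f z) + 2 * K) / (r / 2) ^ n"
proof -
  have sub: "cball z (r / 2) \<subseteq> ball z r"
    using \<open>0 < r\<close> by auto
  have "norm ((deriv ^^ n) f z) \<le> fact n * (norm (f z) + 2 * K) / (r / 2) ^ n"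
  proof (rule Cauchy_inequality)
    show "f holomorphic_on ball z (r / 2)"
      using holomorphic_on_subset[OF hol] sub ball_subset_cball by blast
    show "continuous_on (cball z (r / 2)) f"
      using holomorphic_on_imp_continuous_on holomorphic_on_subset[OF hol sub] by blast
    fix w assume "norm (z - w) = r / 2"
    then have "norm (f w - f z) \<le> 2 * K"
      by (intro Borel_Caratheodory_half[OF assms]) (auto simp: dist_norm)
    then show "norm (f w) \<le> norm (f z) + 2 * K"
      using norm_triangle_sub[of "f w" "f z"] by linarith
  qed (use \<open>0 < r\<close> in auto)
  then have "norm ((deriv ^^ n) f z) / fact n
      \<le> fact n * (norm (f z) + 2 * K) / (r / 2) ^ n / fact n"
    by (intro divide_right_mono) auto
  then show ?thesis
    by (simp add: norm_divide)
qed

text \<open>Here \<open>F\<close> stands for the partition function and \<open>V\<close> for the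
  volume. A zero-free holomorphic function on a disc has a holomorphic logarithm, and
  \<open>ln (norm F)\<close> is its real part. The bound depends only on \<open>A\<close> and
  \<open>r\<close>, hence will be uniform in the volume.\<close>

lemma scaled_ln_norm_power_series:
  fixes F :: "complex \<Rightarrow> complex" and x\<^sub>0 :: real
  assumes hol: "F holomorphic_on ball (of_real x\<^sub>0) r" and "0 < r"
    and nz: "\<And>z. z \<in> ball (of_real x\<^sub>0) r \<Longrightarrow> F z \<noteq> 0"
    and "0 \<le> V"
    and le: "\<And>z. z \<in> ball (of_real x\<^sub>0) r \<Longrightarrow> ln (norm (F z)) / V \<le> A"
    and ge: "0 \<le> ln (norm (F (of_real x\<^sub>0))) / V"
  obtains c where "\<And>n. \<bar>c n\<bar> \<le> (3 * A + 2) / (r / 2) ^ n"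
    and "\<And>t. \<bar>t\<bar> < r \<Longrightarrow> (\<lambda>n. c n * t ^ n) sums (ln (norm (F (of_real (x\<^sub>0 + t)))) / V)"
proof -
  let ?z = "complex_of_real x\<^sub>0"
  obtain h where h: "h holomorphic_on ball ?z r" "\<And>z. z \<in> ball ?z r \<Longrightarrow> F z = exp (h z)"
    using contractible_imp_holomorphic_log[OF hol _ nz] convex_imp_contractible by blast
  \<comment> \<open>Subtracting an imaginary constant leaves the real part alone and makes
    \<open>f\<close> real at the centre, so that its modulus there is controlled by
    \<open>A\<close>. For \<open>V = 0\<close> division yields the constant 0, which is still
    holomorphic.\<close>
  define f where "f = (\<lambda>z. (h z - \<i> * Im (h ?z)) / V)"
  have hol_f: "f holomorphic_on ball ?z r"
    unfolding f_def using h(1) by (cases "V = 0") (auto intro!: holomorphic_intros)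
  have Re_f: "Re (f z) = ln (norm (F z)) / V" if "z \<in> ball ?z r" for z
    using h(2)[OF that] by (simp add: f_def)
  have z: "?z \<in> ball ?z r" using \<open>0 < r\<close> by simp
  have "Im (f ?z) = 0" by (simp add: f_def)
  then have norm_f: "norm (f ?z) = Re (f ?z)"
    using ge Re_f[OF z] by (simp only: cmod_eq_Re abs_of_nonneg)
  have A: "0 \<le> A" using le[OF z] ge by linarith
  define c where "c = (\<lambda>n. Re ((deriv ^^ n) f ?z / fact n))"
  show thesis
  proof
    fix n
    have "\<bar>c n\<bar> \<le> norm ((deriv ^^ n) f ?z / fact n)"
      unfolding c_def by (rule abs_Re_le_cmod)
    \<comment> \<open>The choice \<open>K = A + 1\<close> makes the inequality strict: the real part
      is at most \<open>A\<close> on the disc and nonnegative at the centre. The numerator is then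
      at most \<open>A + 2 * (A + 1)\<close>.\<close>
    also have "\<dots> \<le> (norm (f ?z) + 2 * (A + 1)) / (r / 2) ^ n"
      using A ge le Re_f z
      by (intro Taylor_coeff_bound_Re_bound[OF hol_f \<open>0 < r\<close>]) (fastforce simp: Re_f)+
    also have "\<dots> \<le> (3 * A + 2) / (r / 2) ^ n"
      using \<open>0 < r\<close> le[OF z] by (intro divide_right_mono) (auto simp: norm_f Re_f[OF z])
    finally show "\<bar>c n\<bar> \<le> (3 * A + 2) / (r / 2) ^ n" .
  next
    fix t :: real assume t: "\<bar>t\<bar> < r"
    have mem: "of_real (x\<^sub>0 + t) \<in> ball ?z r"
      using t by (simp add: dist_norm)
    have "(\<lambda>n. Re ((deriv ^^ n) f ?z / fact n * (of_real (x\<^sub>0 + t) - ?z) ^ n))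
        sums Re (f (of_real (x\<^sub>0 + t)))"
      by (rule sums_Re[OF holomorphic_power_series[OF hol_f mem]])
    moreover have "Re (w * (of_real (x\<^sub>0 + t) - ?z) ^ n) = Re w * t ^ n" for w n
      by (simp flip: of_real_power)
    ultimately show "(\<lambda>n. c n * t ^ n) sums (ln (norm (F (of_real (x\<^sub>0 + t)))) / V)"
      by (simp only: Re_f[OF mem] c_def)
  qed
qed

section \<open>Convergence of the coefficients of uniformly bounded power series\<close>

text \<open>A convergence criterion in which the approximant may depend on the accuracy
  \<open>e\<close>: the limits of the approximants form a Cauchy sequence, and its limit is that of
  \<open>f\<close>.\<close>

lemma tendsto_of_approx:
  fixes f :: "'b \<Rightarrow> 'a::complete_space"
  assumes "F \<noteq> bot"
    and approx: "\<And>e. e > 0 \<Longrightarrow>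
      \<exists>u l. (u \<longlongrightarrow> l) F \<and> eventually (\<lambda>x. dist (f x) (u x) \<le> e) F"
  shows "\<exists>l. (f \<longlongrightarrow> l) F"
proof -
  define e where "e = (\<lambda>n. inverse (real (Suc n)))"
  have "\<forall>n. \<exists>u l. (u \<longlongrightarrow> l) F \<and> eventually (\<lambda>x. dist (f x) (u x) \<le> e n) F"
    using approx by (simp add: e_def)
  then obtain u l where u: "\<And>n. (u n \<longlongrightarrow> l n) F"
    and close: "\<And>n. eventually (\<lambda>x. dist (f x) (u n x) \<le> e n) F"
    by metis
  have e0: "e \<longlonglongrightarrow> 0" unfolding e_def by (rule LIMSEQ_inverse_real_of_nat)
  have dist_l: "dist (l m) (l n) \<le> e m + e n" for m n
  proof (rule tendsto_upperbound[OF tendsto_dist[OF u u] _ \<open>F \<noteq> bot\<close>])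
    show "eventually (\<lambda>x. dist (u m x) (u n x) \<le> e m + e n) F"
      using close[of m] close[of n]
    proof eventually_elim
      case (elim x)
      then show ?case
        using dist_triangle3[of "u m x" "u n x" "f x"] by linarith
    qed
  qed
  have "Cauchy l"
  proof (rule metric_CauchyI)
    fix d :: real assume "d > 0"
    then obtain N where N: "\<And>n. n \<ge> N \<Longrightarrow> e n < d / 2"
      using order_tendstoD(2)[OF e0, of "d / 2"] by (auto simp: eventually_sequentially)
    show "\<exists>M. \<forall>m\<ge>M. \<forall>n\<ge>M. dist (l m) (l n) < d"
    proof (intro exI allI impI)
      fix m n assume "m \<ge> N" "n \<ge> N"
      then show "dist (l m) (l n) < d"
        using N[of m] N[of n] dist_l[of m n] by linarith
    qed
  qed
  then obtain l' where l': "l \<longlonglongrightarrow> l'"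
    using Cauchy_convergent_iff convergent_def by blast
  have "(f \<longlongrightarrow> l') F"
  proof (rule tendstoI)
    fix d :: real assume "d > 0"
    then have "eventually (\<lambda>n. dist (l n) l' < d / 3 \<and> e n < d / 3) sequentially"
      using tendstoD[OF l', of "d / 3"] order_tendstoD(2)[OF e0, of "d / 3"]
      by (auto intro: eventually_conj)
    then obtain n where n: "dist (l n) l' < d / 3" "e n < d / 3"
      by (auto simp: eventually_sequentially)
    have "eventually (\<lambda>x. dist (u n x) (l n) < d / 3) F"
      using \<open>d > 0\<close> by (intro tendstoD[OF u]) simp
    with close[of n] show "eventually (\<lambda>x. dist (f x) l' < d) F"
    proof eventually_elim
      case (elim x)
      have "dist (f x) l' \<le> dist (f x) (u n x) + (dist (u n x) (l n) + dist (l n) l')"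
        by (meson add_left_mono dist_triangle order_trans)
      with elim n show ?case by linarith
    qed
  qed
  then show ?thesis by blast
qed

lemma power_series_summable_of_coeff_bound:
  fixes a :: "nat \<Rightarrow> 'a::{banach,real_normed_div_algebra}"
  assumes bound: "\<And>n. norm (a n) \<le> M / r ^ n" and "norm w < r"
  shows "summable (\<lambda>n. a n * w ^ n)"
proof (rule summable_comparison_test')
  have "0 < r" using assms(2) norm_ge_zero le_less_trans by blast
  then show "summable (\<lambda>n. M * (norm w / r) ^ n)"
    using assms(2) by (intro summable_mult summable_geometric) simp
  show "norm (a n * w ^ n) \<le> M * (norm w / r) ^ n" for n
    using mult_right_mono[OF bound[of n], of "norm w ^ n"]
    by (simp add: norm_mult norm_power power_divide)
qed

text \<open>The terms beyond index \<open>n\<close> at the point \<open>s * r\<close> are dominated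
  by a geometric series of size \<open>s ^ Suc n\<close>; dividing by \<open>(s * r) ^ n\<close>
  leaves one factor \<open>s\<close>. The error depends on \<open>c\<close> only through
  \<open>M\<close> and \<open>r\<close>, so it is uniform over a family of series.\<close>

lemma power_series_coeff_approx:
  fixes c :: "nat \<Rightarrow> real"
  assumes bound: "\<And>n. \<bar>c n\<bar> \<le> M / r ^ n"
    and sums: "(\<lambda>n. c n * (s * r) ^ n) sums y"
    and "0 < r" "0 < s" "s \<le> 1/2"
  shows "\<bar>c n - (y - (\<Sum>k<n. c k * (s * r) ^ k)) / (s * r) ^ n\<bar> \<le> 2 * M * s / r ^ n"
proof -
  let ?t = "s * r"
  have M: "0 \<le> M" using bound[of 0] by simp
  have t: "0 < ?t" using assms by simp
  have term_le: "norm (c (j + Suc n) * ?t ^ (j + Suc n)) \<le> M * s ^ Suc n * s ^ j" for j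
    using mult_right_mono[OF bound[of "j + Suc n"], of "?t ^ (j + Suc n)"] assms(3,4)
    by (simp add: abs_mult power_mult_distrib power_add field_simps)
  have geo: "(\<lambda>j. M * s ^ Suc n * s ^ j) sums (M * s ^ Suc n * (1 / (1 - s)))"
    using assms by (intro sums_mult geometric_sums) simp
  have "norm (y - (\<Sum>k<Suc n. c k * ?t ^ k)) \<le> M * s ^ Suc n * (1 / (1 - s))"
    by (rule norm_sums_le[OF sums_split_initial_segment[OF sums] geo term_le])
  \<comment> \<open>From \<open>s \<le> 1/2\<close> follows
    \<open>1 / (1 - s) \<le> 2\<close>.\<close>
  also have "\<dots> \<le> M * s ^ Suc n * 2"
    using assms M by (intro mult_left_mono) (auto simp: field_simps)
  finally have *: "\<bar>y - (\<Sum>k<n. c k * ?t ^ k) - c n * ?t ^ n\<bar> \<le> M * s ^ Suc n * 2"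
    by (simp add: algebra_simps)
  have "\<bar>c n - (y - (\<Sum>k<n. c k * ?t ^ k)) / ?t ^ n\<bar>
      = \<bar>y - (\<Sum>k<n. c k * ?t ^ k) - c n * ?t ^ n\<bar> / ?t ^ n"
  proof -
    have "c n - w / ?t ^ n = - ((w - c n * ?t ^ n) / ?t ^ n)" for w
      using less_imp_neq[OF t] by (auto simp: diff_divide_distrib)
    then show ?thesis using t by (simp only: abs_minus abs_divide) simp
  qed
  also have "\<dots> \<le> M * s ^ Suc n * 2 / ?t ^ n"
    using t * by (intro divide_right_mono) auto
  also have "\<dots> = 2 * M * s / r ^ n"
    using assms by (simp add: power_mult_distrib)
  finally show ?thesis .
qed

text \<open>The uniform coefficient bound upgrades pointwise convergence on a real interval to
  convergence of every coefficient. The limits inherit the bound, and Tannery's theorem identifies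
  their series with \<open>p\<close>.\<close>

lemma power_series_coeffs_tendsto:
  fixes c :: "'b \<Rightarrow> nat \<Rightarrow> real" and f :: "'b \<Rightarrow> real \<Rightarrow> real"
  assumes "F \<noteq> bot" "0 < r"
    and bound: "eventually (\<lambda>x. \<forall>n. \<bar>c x n\<bar> \<le> M / r ^ n) F"
    and sums: "eventually (\<lambda>x. \<forall>t. \<bar>t\<bar> < r \<longrightarrow> (\<lambda>n. c x n * t ^ n) sums f x t) F"
    and lim: "\<And>t. \<bar>t\<bar> < r \<Longrightarrow> ((\<lambda>x. f x t) \<longlongrightarrow> p t) F"
  obtains a where "\<And>n. ((\<lambda>x. c x n) \<longlongrightarrow> a n) F" "\<And>n. \<bar>a n\<bar> \<le> M / r ^ n"
    "\<And>t. \<bar>t\<bar> < r \<Longrightarrow> (\<lambda>n. a n * t ^ n) sums p t"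
proof -
  \<comment> \<open>The bound at index 0 gives a statement free of \<open>x\<close>, which can be
    extracted since the filter is nontrivial.\<close>
  have "eventually (\<lambda>x. 0 \<le> M) F"
    using bound by eventually_elim (drule spec[of _ 0], simp)
  then have M: "0 \<le> M" using \<open>F \<noteq> bot\<close> by simp
  have "\<exists>l. ((\<lambda>x. c x n) \<longlongrightarrow> l) F" for n
  proof (induction n rule: less_induct)
    case (less n)
    then obtain l where l: "\<And>k. k < n \<Longrightarrow> ((\<lambda>x. c x k) \<longlongrightarrow> l k) F"
      by metis
    show ?case
    proof (rule tendsto_of_approx[OF \<open>F \<noteq> bot\<close>])
      fix e :: real assume "e > 0"
      \<comment> \<open>Small enough for an error of at most \<open>e\<close>; the denominator
        \<open>2 * M + 1\<close> instead of \<open>2 * M\<close> covers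
        \<open>M = 0\<close>.\<close>
      define s where "s = min (1/2) (e * r ^ n / (2 * M + 1))"
      have s: "0 < s" "s \<le> 1/2"
        using \<open>e > 0\<close> \<open>0 < r\<close> M unfolding s_def by (simp, intro min.cobounded1)
      have "s * (2 * M + 1) \<le> e * r ^ n"
        using M min.cobounded2[of "1/2" "e * r ^ n / (2 * M + 1)"]
        by (simp add: s_def[symmetric] pos_le_divide_eq)
      then have small: "2 * M * s / r ^ n \<le> e"
        using s \<open>0 < r\<close> by (simp add: divide_simps algebra_simps)
      have "0 < s * r" "\<bar>s * r\<bar> < r"
        using s mult_strict_right_mono[of s 1 r] \<open>0 < r\<close> by (auto simp: abs_mult)
      let ?u = "\<lambda>x. (f x (s * r) - (\<Sum>k<n. c x k * (s * r) ^ k)) / (s * r) ^ n"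
      \<comment> \<open>With the evaluation point \<open>s * r\<close> fixed, only the sum and the
        lower coefficients vary; the latter converge by induction.\<close>
      have "(?u \<longlongrightarrow> (p (s * r) - (\<Sum>k<n. l k * (s * r) ^ k)) / (s * r) ^ n) F"
        using \<open>0 < s * r\<close> \<open>\<bar>s * r\<bar> < r\<close> l by (intro tendsto_intros lim) auto
      moreover have "eventually (\<lambda>x. dist (c x n) (?u x) \<le> e) F"
        using bound sums
      proof eventually_elim
        case (elim x)
        then have "\<bar>c x n - ?u x\<bar> \<le> 2 * M * s / r ^ n"
          using s \<open>0 < r\<close> \<open>\<bar>s * r\<bar> < r\<close> by (intro power_series_coeff_approx) auto
        with small show ?case by (simp add: dist_real_def)
      qed
      ultimately show "\<exists>u l. (u \<longlongrightarrow> l) F \<and> eventually (\<lambda>x. dist (c x n) (u x) \<le> e) F"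
        by blast
    qed
  qed
  then obtain a where a: "\<And>n. ((\<lambda>x. c x n) \<longlongrightarrow> a n) F" by metis
  have a_bound: "\<bar>a n\<bar> \<le> M / r ^ n" for n
    using bound by (intro tendsto_upperbound[OF tendsto_rabs[OF a] _ \<open>F \<noteq> bot\<close>])
                   (auto elim: eventually_mono)
  show thesis
  proof (rule that[OF a a_bound])
    fix t :: real assume t: "\<bar>t\<bar> < r"
    have "eventually (\<lambda>x. \<forall>k. norm (c x k * t ^ k) \<le> M * (\<bar>t\<bar> / r) ^ k) F"
      using bound
    proof eventually_elim
      case (elim x)
      then show ?case
        using mult_right_mono[of "\<bar>c x k\<bar>" "M / r ^ k" "\<bar>t\<bar> ^ k" for k]
        by (simp add: abs_mult power_abs power_divide)
    qed
    \<comment> \<open>Tannery's theorem expects domination along the product filter; here it holds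
      for every \<open>k\<close>.\<close>
    from eventually_prodI[OF eventually_True[of sequentially] this]
    have dominated: "eventually (\<lambda>(k, x). norm (c x k * t ^ k) \<le> M * (\<bar>t\<bar> / r) ^ k)
        (sequentially \<times>\<^sub>F F)"
      by (rule eventually_mono) auto
    have "((\<lambda>x. \<Sum>k. c x k * t ^ k) \<longlongrightarrow> (\<Sum>k. a k * t ^ k)) F"
    proof (rule tannerys_theorem[THEN conjunct2, THEN conjunct2])
      show "((\<lambda>x. c x k * t ^ k) \<longlongrightarrow> a k * t ^ k) F" for k
        by (intro tendsto_intros a)
      show "eventually (\<lambda>(k, x). norm (c x k * t ^ k) \<le> M * (\<bar>t\<bar> / r) ^ k)
          (sequentially \<times>\<^sub>F F)"
        by (rule dominated)
      show "summable (\<lambda>k. M * (\<bar>t\<bar> / r) ^ k)"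
        using t \<open>0 < r\<close> by (intro summable_mult summable_geometric) simp
    qed fact
    moreover have "eventually (\<lambda>x. (\<Sum>k. c x k * t ^ k) = f x t) F"
      using sums by eventually_elim (use t in \<open>auto simp: sums_iff\<close>)
    ultimately have "((\<lambda>x. f x t) \<longlongrightarrow> (\<Sum>k. a k * t ^ k)) F"
      by (rule Lim_transform_eventually)
    then have "(\<Sum>k. a k * t ^ k) = p t"
      using tendsto_unique[OF \<open>F \<noteq> bot\<close> _ lim[OF t]] by blast
    moreover have "summable (\<lambda>k. a k * t ^ k)"
      using a_bound t by (intro power_series_summable_of_coeff_bound[of a M r]) auto
    ultimately show "(\<lambda>n. a n * t ^ n) sums p t"
      by (simp add: sums_iff)
  qed
qed

section \<open>Iterated derivatives of power series\<close>

text \<open>Induction with \<open>f\<close> and \<open>a\<close> arbitrary: \<open>deriv f\<close>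
  has the coefficients \<open>diffs a\<close>, again on the whole disc. This turns convergence of
  coefficients into convergence of real derivatives.\<close>

lemma higher_deriv_power_series:
  fixes f :: "'a::{real_normed_field,banach} \<Rightarrow> 'a"
  assumes "0 < r" and "\<And>t. norm t < r \<Longrightarrow> (\<lambda>n. a n * t ^ n) sums f (x + t)"
  shows "(deriv ^^ n) f x = fact n * a n"
  using assms(2)
proof (induction n arbitrary: f a)
  case 0
  from sums_unique2[OF 0[of 0] powser_sums_zero[of a]] \<open>0 < r\<close> show ?case by simp
next
  case (Suc n)
  have "(\<lambda>n. diffs a n * t ^ n) sums deriv f (x + t)" if t: "norm t < r" for t
  proof -
    have smb: "summable (\<lambda>n. a n * w ^ n)" if "norm w < r" for w
      using Suc.prems[OF that] by (simp add: sums_iff)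
    have "((\<lambda>t. \<Sum>n. a n * t ^ n) has_field_derivative (\<Sum>n. diffs a n * t ^ n)) (at t)"
      by (rule termdiffs_strong'[OF smb t])
    then have "((\<lambda>t. f (x + t)) has_field_derivative (\<Sum>n. diffs a n * t ^ n)) (at t)"
    proof (rule has_field_derivative_transform_within_open)
      show "open (ball (0::'a) r)" "t \<in> ball 0 r" using t by auto
      show "(\<Sum>n. a n * w ^ n) = f (x + w)" if "w \<in> ball 0 r" for w
        using Suc.prems[of w] that by (simp add: sums_iff)
    qed
    then have "(f has_field_derivative (\<Sum>n. diffs a n * t ^ n)) (at (x + t))"
      by (simp add: DERIV_shift add.commute)
    then show ?thesis
      using termdiff_converges[OF t smb] by (simp add: DERIV_imp_deriv summable_sums)
  qed
  from Suc.IH[OF this] show ?case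
    by (simp add: funpow_swap1 diffs_def algebra_simps)
qed

section \<open>Analyticity of the partition function\<close>

text \<open>Since \<open>enn2real\<close> sends infinity to 0, the real series represents
  \<open>\<Xi>_nonneg\<close> only if each integral is finite. This is read off at fugacity 1, where
  each integral has the positive weight \<open>1 / fact N\<close>.\<close>

lemma config_integral_summable:
  fixes b :: "(real^'d) boundary_condition"
  assumes fin: "\<forall>x\<ge>0. \<Xi>_nonneg \<beta> \<phi> L b x < \<infinity>" and "0 \<le> x"
  shows "summable (\<lambda>N. x ^ N / fact N * enn2real (config_integral \<beta> \<phi> L b N))"
proof -
  let ?C = "config_integral \<beta> \<phi> L b"
  have C: "?C N < \<infinity>" for N
  proof -
    have "ennreal (1 ^ N / fact N) * ?C N \<le> \<Xi>_nonneg \<beta> \<phi> L b 1"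
      using sum_le_suminf[of "\<lambda>N. ennreal (1 ^ N / fact N) * ?C N" "{N}"]
      by (simp add: \<Xi>_nonneg_def)
    also have "\<dots> < \<infinity>" using fin by simp
    finally show ?thesis
      by (auto simp: ennreal_mult_eq_top_iff less_top[symmetric] ennreal_mult_less_top)
  qed
  have "(\<Sum>N. ennreal (x ^ N / fact N * enn2real (?C N))) = \<Xi>_nonneg \<beta> \<phi> L b x"
    unfolding \<Xi>_nonneg_def using C \<open>0 \<le> x\<close>
    by (intro suminf_cong) (simp only: ennreal_mult' ennreal_enn2real zero_le_divide_iff
      zero_le_power fact_ge_zero infinity_ennreal_def simp_thms)
  then show ?thesis
    using fin \<open>0 \<le> x\<close> by (intro summable_suminf_not_top) auto
qed

text \<open>The coefficients are nonnegative and the series converges at every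
  \<open>x \<ge> 0\<close>, so it converges absolutely on the whole plane.\<close>

lemma partition_function_entire:
  fixes b :: "(real^'d) boundary_condition"
  assumes fin: "\<forall>x\<ge>0. \<Xi>_nonneg \<beta> \<phi> L b x < \<infinity>"
  shows "(\<Xi> \<beta> \<phi> L b :: complex \<Rightarrow> complex) holomorphic_on S"
    and "norm (\<Xi> \<beta> \<phi> L b z :: complex) \<le> \<Xi> \<beta> \<phi> L b (norm z)"
    and "\<Xi> \<beta> \<phi> L b (complex_of_real x) = complex_of_real (\<Xi> \<beta> \<phi> L b x)"
    and "0 \<le> x \<Longrightarrow> 1 \<le> \<Xi> \<beta> \<phi> L b x"
proof -
  define a where "a = (\<lambda>N. enn2real (config_integral \<beta> \<phi> L b N) / fact N)"
  have a: "0 \<le> a N" for N by (simp add: a_def)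
  have \<Xi>_real: "\<Xi> \<beta> \<phi> L b y = (\<Sum>N. a N * y ^ N)" for y :: real
    by (simp add: \<Xi>_def a_def mult.commute)
  have \<Xi>_complex: "\<Xi> \<beta> \<phi> L b w = (\<Sum>N. of_real (a N) * w ^ N)" for w :: complex
    by (simp add: \<Xi>_def a_def mult.commute)
  have smb: "summable (\<lambda>N. a N * y ^ N)" if "0 \<le> y" for y
    using config_integral_summable[OF fin that] by (simp add: a_def mult.commute)
  have norm_smb: "summable (\<lambda>N. norm (of_real (a N) * w ^ N))" for w :: complex
    using smb[of "norm w"] a by (simp add: norm_mult norm_power)
  have sums: "(\<lambda>N. of_real (a N) * w ^ N) sums \<Xi> \<beta> \<phi> L b w" for w :: complex
    unfolding \<Xi>_complex by (rule summable_sums[OF summable_norm_cancel[OF norm_smb]])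
  have "\<Xi> \<beta> \<phi> L b holomorphic_on ball 0 (norm w + 1)" for w :: complex
    using sums by (intro power_series_holomorphic[of 0 _ "\<lambda>N. of_real (a N)"]) simp
  then have "\<Xi> \<beta> \<phi> L b field_differentiable at w" for w :: complex
    by (rule holomorphic_on_imp_differentiable_at[where s = "ball 0 (norm w + 1)"]) auto
  then show "(\<Xi> \<beta> \<phi> L b :: complex \<Rightarrow> complex) holomorphic_on S"
    by (simp add: holomorphic_on_def field_differentiable_at_within)
  have "norm (\<Xi> \<beta> \<phi> L b z) \<le> (\<Sum>N. norm (of_real (a N) * z ^ N))"
    unfolding \<Xi>_complex by (rule summable_norm[OF norm_smb])
  also have "\<dots> = \<Xi> \<beta> \<phi> L b (norm z)"
    using a by (simp add: \<Xi>_real norm_mult norm_power)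
  finally show "norm (\<Xi> \<beta> \<phi> L b z) \<le> \<Xi> \<beta> \<phi> L b (norm z)" .
  \<comment> \<open>Here \<open>x\<close> may be negative, so summability comes from absolute
    convergence of the complex series.\<close>
  have "norm (a N * x ^ N) = norm (complex_of_real (a N) * of_real x ^ N)" for N
    by (simp only: norm_mult norm_power norm_of_real) simp
  then have "summable (\<lambda>N. a N * x ^ N)"
    using norm_smb[of "of_real x"] by (simp only: summable_norm_cancel)
  then have "(\<lambda>N. a N * x ^ N) sums \<Xi> \<beta> \<phi> L b x"
    unfolding \<Xi>_real by (rule summable_sums)
  from sums_of_real[OF this, where 'a = complex]
  have "(\<lambda>N. complex_of_real (a N) * of_real x ^ N) sums of_real (\<Xi> \<beta> \<phi> L b x)"
    by (simp only: of_real_mult of_real_power)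
  with sums[of "of_real x"]
  show "\<Xi> \<beta> \<phi> L b (complex_of_real x) = complex_of_real (\<Xi> \<beta> \<phi> L b x)"
    by (rule sums_unique2)
  show "1 \<le> \<Xi> \<beta> \<phi> L b x" if "0 \<le> x"
  proof -
    \<comment> \<open>The term \<open>N = 0\<close> alone contributes 1.\<close>
    have "(\<Sum>N\<in>{0}. a N * x ^ N) \<le> (\<Sum>N. a N * x ^ N)"
      using smb[OF that] a that by (intro sum_le_suminf) auto
    then show ?thesis
      by (simp add: \<Xi>_real a_def config_integral_0)
  qed
qed

section \<open>Taylor expansion of the pressure and its thermodynamic limit\<close>

text \<open>Admissibility gives the upper bound and \<open>\<Xi> \<ge> 1\<close> the lower bound at
  \<open>z\<^sub>0\<close> that the coefficient estimate requires, with constants independent of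
  \<open>L\<close>.\<close>

lemma pressure_Taylor_coeffs:
  fixes b :: "(real^'d) boundary_condition"
  assumes adm: "admissible \<beta> \<phi> \<B>" and b: "b \<in> \<B>" and "0 < z\<^sub>0"
    and zf: "zero_free_near \<beta> \<phi> b z\<^sub>0"
  obtains r M c where "0 < r" "r \<le> z\<^sub>0"
    "\<forall>\<^sub>F L in at_top. \<forall>n. \<bar>c L n\<bar> \<le> M / r ^ n"
    "\<forall>\<^sub>F L in at_top. \<forall>t. \<bar>t\<bar> < r \<longrightarrow> (\<lambda>n. c L n * t ^ n) sums pressure \<beta> \<phi> L b (z\<^sub>0 + t)"
proof -
  obtain \<delta> where "\<delta> > 0"
    and \<delta>: "\<forall>\<^sub>F L in at_top. \<forall>z\<in>ball (complex_of_real z\<^sub>0) \<delta>. \<Xi> \<beta> \<phi> L b z \<noteq> 0"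
    using zf by (auto simp: zero_free_near_def)
  obtain c\<^sub>1 c\<^sub>2 L\<^sub>1 where adm': "\<And>(z::complex) L. L \<ge> 1 \<Longrightarrow> L \<ge> L\<^sub>1 \<Longrightarrow>
        \<Xi>_nonneg \<beta> \<phi> L b (norm z) < \<infinity> \<and> pressure \<beta> \<phi> L b (norm z) \<le> c\<^sub>1 * norm z + c\<^sub>2"
    using adm b unfolding admissible_def by blast
  \<comment> \<open>Besides staying in the zero-free disc, this keeps \<open>z\<^sub>0 + t\<close>
    nonnegative and \<open>norm z \<le> 2 * z\<^sub>0\<close> on the disc; \<open>A\<close> then
    bounds \<open>c\<^sub>1 * norm z + c\<^sub>2\<close> there for either sign of
    \<open>c\<^sub>1\<close>.\<close>
  define R where "R = min \<delta> z\<^sub>0"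
  have R: "0 < R" "R \<le> \<delta>" "R \<le> z\<^sub>0" using \<open>\<delta> > 0\<close> \<open>0 < z\<^sub>0\<close> by (auto simp: R_def)
  define A where "A = \<bar>c\<^sub>1\<bar> * (2 * z\<^sub>0) + c\<^sub>2"
  let ?good = "\<lambda>L c. (\<forall>n. \<bar>c n\<bar> \<le> (3 * A + 2) / (R / 2) ^ n) \<and>
     (\<forall>t. \<bar>t\<bar> < R \<longrightarrow> (\<lambda>n. c n * t ^ n) sums pressure \<beta> \<phi> L b (z\<^sub>0 + t))"
  have "\<forall>\<^sub>F L in at_top. \<exists>c. ?good L c"
    using \<delta> eventually_ge_at_top[of 1] eventually_ge_at_top[of L\<^sub>1]
  proof eventually_elim
    case (elim L)
    let ?V = "measure lborel (cube L :: (real^'d) set)"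
    have fin: "\<forall>x\<ge>0. \<Xi>_nonneg \<beta> \<phi> L b x < \<infinity>"
      and le: "\<forall>x\<ge>0. pressure \<beta> \<phi> L b x \<le> c\<^sub>1 * x + c\<^sub>2"
      using adm'[of L "of_real x" for x] elim by (simp_all, metis abs_of_nonneg, metis abs_of_nonneg)
    note \<Xi> = partition_function_entire[OF fin]
    obtain c where c: "\<And>n. \<bar>c n\<bar> \<le> (3 * A + 2) / (R / 2) ^ n"
      "\<And>t. \<bar>t\<bar> < R \<Longrightarrow>
        (\<lambda>n. c n * t ^ n) sums (ln (norm (\<Xi> \<beta> \<phi> L b (complex_of_real (z\<^sub>0 + t)))) / ?V)"
    proof (rule scaled_ln_norm_power_series)
      show "(\<Xi> \<beta> \<phi> L b :: complex \<Rightarrow> complex) holomorphic_on ball (of_real z\<^sub>0) R"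
        by (rule \<Xi>(1))
      show nz: "\<Xi> \<beta> \<phi> L b z \<noteq> 0" if "z \<in> ball (complex_of_real z\<^sub>0) R" for z
        using elim(1) that R by auto
      show "ln (norm (\<Xi> \<beta> \<phi> L b z)) / ?V \<le> A" if z: "z \<in> ball (complex_of_real z\<^sub>0) R" for z
      proof -
        \<comment> \<open>The modulus at \<open>z\<close> is at most the value at the real fugacity
          \<open>norm z\<close>, where admissibility applies.\<close>
        have "ln (norm (\<Xi> \<beta> \<phi> L b z)) / ?V \<le> pressure \<beta> \<phi> L b (norm z)"
          unfolding pressure_def using nz[OF z] \<Xi>(2)[of z]
          by (intro divide_right_mono ln_mono) auto
        also have "\<dots> \<le> c\<^sub>1 * norm z + c\<^sub>2" using le by simp
        also have "\<dots> \<le> A"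
        proof -
          have "norm z \<le> 2 * z\<^sub>0"
            using z R norm_triangle_sub[of z "of_real z\<^sub>0"] \<open>0 < z\<^sub>0\<close>
            by (simp add: dist_norm norm_minus_commute)
          then have "c\<^sub>1 * norm z \<le> \<bar>c\<^sub>1\<bar> * (2 * z\<^sub>0)"
            by (intro mult_mono) auto
          then show ?thesis by (simp add: A_def)
        qed
        finally show ?thesis .
      qed
      show "0 \<le> ln (norm (\<Xi> \<beta> \<phi> L b (complex_of_real z\<^sub>0))) / ?V"
        using \<Xi>(4)[of z\<^sub>0] \<open>0 < z\<^sub>0\<close> by (simp add: \<Xi>(3))
    qed (use R in auto)
    have "(\<lambda>n. c n * t ^ n) sums pressure \<beta> \<phi> L b (z\<^sub>0 + t)" if "\<bar>t\<bar> < R" for t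
    proof -
      have "0 \<le> z\<^sub>0 + t" using that R by linarith
      then have "norm (\<Xi> \<beta> \<phi> L b (complex_of_real (z\<^sub>0 + t))) = \<Xi> \<beta> \<phi> L b (z\<^sub>0 + t)"
        using \<Xi>(4)[of "z\<^sub>0 + t"] unfolding \<Xi>(3) norm_of_real by linarith
      with c(2)[OF that] show ?thesis
        by (simp only: pressure_def)
    qed
    with c(1) show ?case by blast
  qed
  \<comment> \<open>One coefficient sequence is selected for each \<open>L\<close>; the values at
    small \<open>L\<close> are arbitrary and do not affect limits.\<close>
  define c where "c = (\<lambda>L. SOME c. ?good L c)"
  have "\<forall>\<^sub>F L in at_top. ?good L (c L)"
    using \<open>\<forall>\<^sub>F L in at_top. \<exists>c. ?good L c\<close> unfolding c_def
    by (rule eventually_mono) (rule someI_ex[of "?good _"])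
  then show thesis
    \<comment> \<open>The radius is halved so that the coefficient bound and the expansion refer to
      the same \<open>r\<close>.\<close>
    using R by (intro that[of "R / 2" c "3 * A + 2"]) (auto elim: eventually_mono)
qed

text \<open>Derivatives at \<open>z\<^sub>0\<close> are \<open>fact n\<close> times Taylor
  coefficients, both for finite \<open>L\<close> and for \<open>p\<close>, so the convergence of
  coefficients is the claim.\<close>

lemma pressure_limit_power_series:
  fixes b :: "(real^'d) boundary_condition"
  assumes "admissible \<beta> \<phi> \<B>" "b \<in> \<B>" "0 < z\<^sub>0" "zero_free_near \<beta> \<phi> b z\<^sub>0"
    and lim: "\<And>x. 0 < x \<Longrightarrow> ((\<lambda>L. pressure \<beta> \<phi> L b x) \<longlongrightarrow> p x) at_top"
  obtains r M a where "0 < r" "r \<le> z\<^sub>0" "\<And>n. \<bar>a n\<bar> \<le> M / r ^ n"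
    "\<And>t. \<bar>t\<bar> < r \<Longrightarrow> (\<lambda>n. a n * t ^ n) sums p (z\<^sub>0 + t)"
    "\<And>n. ((\<lambda>L. (deriv ^^ n) (pressure \<beta> \<phi> L b) z\<^sub>0) \<longlongrightarrow> (deriv ^^ n) p z\<^sub>0) at_top"
proof -
  obtain r M c where r: "0 < r" "r \<le> z\<^sub>0"
    and bound: "\<forall>\<^sub>F L in at_top. \<forall>n. \<bar>c L n\<bar> \<le> M / r ^ n"
    and sums: "\<forall>\<^sub>F L in at_top. \<forall>t. \<bar>t\<bar> < r \<longrightarrow>
      (\<lambda>n. c L n * t ^ n) sums pressure \<beta> \<phi> L b (z\<^sub>0 + t)"
    by (rule pressure_Taylor_coeffs[OF assms(1-4)]) blast
  obtain a where a: "\<And>n. ((\<lambda>L. c L n) \<longlongrightarrow> a n) at_top" "\<And>n. \<bar>a n\<bar> \<le> M / r ^ n"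
    "\<And>t. \<bar>t\<bar> < r \<Longrightarrow> (\<lambda>n. a n * t ^ n) sums p (z\<^sub>0 + t)"
    \<comment> \<open>For \<open>\<bar>t\<bar> < r\<close> and \<open>r \<le> z\<^sub>0\<close> the
      point \<open>z\<^sub>0 + t\<close> is positive, where the pressure converges.\<close>
    by (rule power_series_coeffs_tendsto[OF _ r(1) bound sums, of "\<lambda>t. p (z\<^sub>0 + t)"])
       (use r in \<open>auto intro!: lim\<close>)
  have "((\<lambda>L. (deriv ^^ n) (pressure \<beta> \<phi> L b) z\<^sub>0) \<longlongrightarrow> (deriv ^^ n) p z\<^sub>0) at_top" for n
  proof (rule Lim_transform_eventually)
    have "(deriv ^^ n) p z\<^sub>0 = fact n * a n"
      using a(3) by (intro higher_deriv_power_series[OF r(1)]) simp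
    then show "((\<lambda>L. fact n * c L n) \<longlongrightarrow> (deriv ^^ n) p z\<^sub>0) at_top"
      by (simp add: tendsto_mult_left[OF a(1)])
    show "\<forall>\<^sub>F L in at_top. fact n * c L n = (deriv ^^ n) (pressure \<beta> \<phi> L b) z\<^sub>0"
      using sums
    proof eventually_elim
      case (elim L)
      then show ?case
        by (intro higher_deriv_power_series[OF r(1), symmetric]) simp
    qed
  qed
  with r a(2,3) show thesis by (rule that)
qed

theorem theorem1p1:
  fixes \<phi> :: "real^'d \<Rightarrow> ereal"
    and \<beta> z\<^sub>0 :: real
    and \<B> :: "(real^'d) boundary_condition set"
    and b :: "(real^'d) boundary_condition"
    and p :: "real \<Rightarrow> real"
  assumes "\<beta> > 0"
    and "pair_potential \<phi>" and "stable_potential \<phi>" and "tempered \<phi>" and "lower_regular \<phi>"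
    and "\<forall>b\<in>\<B>. is_boundary_condition b"
    and "admissible \<beta> \<phi> \<B>"
    and "\<forall>x>0. \<forall>b\<in>\<B>. ((\<lambda>L. pressure \<beta> \<phi> L b x) \<longlongrightarrow> p x) at_top"
    and "z\<^sub>0 > 0" and "b \<in> \<B>"
    and "zero_free_near \<beta> \<phi> b z\<^sub>0"
  shows "(\<exists>U g. open U \<and> complex_of_real z\<^sub>0 \<in> U \<and> g holomorphic_on U \<and>
            (\<forall>x>0. complex_of_real x \<in> U \<longrightarrow> g (complex_of_real x) = complex_of_real (p x))) \<and>
         (\<forall>n\<ge>1. ((\<lambda>L. (deriv ^^ n) (pressure \<beta> \<phi> L b) z\<^sub>0) \<longlongrightarrow> (deriv ^^ n) p z\<^sub>0) at_top) \<and>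
         (\<forall>b'\<in>\<B>. zero_free_near \<beta> \<phi> b' z\<^sub>0 \<longrightarrow>
            (\<forall>n\<ge>1. ((\<lambda>L. (deriv ^^ n) (pressure \<beta> \<phi> L b') z\<^sub>0) \<longlongrightarrow> (deriv ^^ n) p z\<^sub>0) at_top))"
proof -
  \<comment> \<open>Stated for every zero-free \<open>b'\<close>: the limit involves only
    \<open>p\<close>, which gives the independence of the boundary condition.\<close>
  have deriv_lim: "((\<lambda>L. (deriv ^^ n) (pressure \<beta> \<phi> L b') z\<^sub>0) \<longlongrightarrow> (deriv ^^ n) p z\<^sub>0) at_top"
    if "b' \<in> \<B>" "zero_free_near \<beta> \<phi> b' z\<^sub>0" for b' n
    by (rule pressure_limit_power_series[OF assms(7) that(1) assms(9) that(2), of p])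
       (use assms(8) that(1) in auto)
  obtain r M a where r: "0 < r" "r \<le> z\<^sub>0" and a_bound: "\<And>n. \<bar>a n\<bar> \<le> M / r ^ n"
    and a_sums: "\<And>t. \<bar>t\<bar> < r \<Longrightarrow> (\<lambda>n. a n * t ^ n) sums p (z\<^sub>0 + t)"
    by (rule pressure_limit_power_series[OF assms(7,10,9,11), of p]) (use assms(8,10) in auto)
  \<comment> \<open>The extension is the real Taylor series of \<open>p\<close> at
    \<open>z\<^sub>0\<close>, evaluated at complex arguments; the coefficient bound makes it
    converge on the disc of radius \<open>r\<close>.\<close>
  define g where "g = (\<lambda>z. \<Sum>n. complex_of_real (a n) * (z - of_real z\<^sub>0) ^ n)"
  have g_sums: "(\<lambda>n. complex_of_real (a n) * (z - of_real z\<^sub>0) ^ n) sums g z"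
    if "z \<in> ball (of_real z\<^sub>0) r" for z
    unfolding g_def using that a_bound
    by (intro summable_sums power_series_summable_of_coeff_bound[of _ M r])
       (auto simp: dist_norm norm_minus_commute)
  have "g (of_real x) = of_real (p x)" if "complex_of_real x \<in> ball (of_real z\<^sub>0) r" for x
  proof -
    have "\<bar>x - z\<^sub>0\<bar> < r"
      using that unfolding mem_ball dist_of_real dist_real_def by linarith
    from sums_of_real[OF a_sums[OF this], where 'a = complex]
    have "(\<lambda>n. complex_of_real (a n) * (of_real x - of_real z\<^sub>0) ^ n) sums of_real (p x)"
      by simp
    with g_sums[OF that] show ?thesis by (rule sums_unique2)
  qed
  moreover have "g holomorphic_on ball (of_real z\<^sub>0) r"
    using g_sums by (rule power_series_holomorphic)
  ultimately have "\<exists>U g. open U \<and> complex_of_real z\<^sub>0 \<in> U \<and> g holomorphic_on U \<and>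
      (\<forall>x>0. complex_of_real x \<in> U \<longrightarrow> g (complex_of_real x) = complex_of_real (p x))"
    using r by (intro exI[of _ "ball (of_real z\<^sub>0) r"] exI[of _ g]) auto
  with deriv_lim assms(10,11) show ?thesis by blast
qed

end
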